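(* Let $((Y_{n,1},Y_{n,2}))_{n\geqslant 0}$ be a sequence of $\mathbb{R}^2$-valued random variables such that, for each $n$, $Y_{n,1}$ and $Y_{n,2}$ are independent. Let $(v_n)_{n\geqslant 0}$ be a positive sequence diverging to $\infty$. For all $a\in\mathbb{R}$ and $i\in\{1,2\}$, define $$\underline{I}_i(a)=-\inf_{u<a}\liminf_{n\to\infty}\frac{1}{v_n}\log\mathbb{P}(Y_{n,i}>u),\qquad \overline{I}_i(a)=-\inf_{u<a}\limsup_{n\to\infty}\frac{1}{v_n}\log\mathbb{P}(Y_{n,i}>u).$$ Assume that for all $M>0$ there exists $d>0$ such that $$\limsup_{n\to\infty}\frac{1}{v_n}\log\mathbb{P}(Y_{n,1}>d,\ Y_{n,2}<-d)<-M\quad\text{and}\quad \limsup_{n\to\infty}\frac{1}{v_n}\log\mathbb{P}(Y_{n,1}<-d,\ Y_{n,2}>d)<-M.$$ For all $t\in\mathbb{R}$, define $$\underline{I}(t)=\inf_{\substack{a,b\in\mathbb{R}\\ a+b=t}}\bigl(\underline{I}_1(a)+\underline{I}_2(b)\bigr),\qquad \overline{I}(t)=\inf_{\substack{a,b\in\mathbb{R}\\ a+b=t}}\bigl(\overline{I}_1(a)+\overline{I}_2(b)\bigr).$$ Then, for all $c\in\mathbb{R}$, $$-\inf_{t>c}\underline{I}(t)\leqslant\liminf_{n\to\infty}\frac{1}{v_n}\log\mathbb{P}(Y_{n,1}+Y_{n,2}>c)\leqslant\limsup_{n\to\infty}\frac{1}{v_n}\log\mathbb{P}(Y_{n,1}+Y_{n,2}\geqslant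 c)\leqslant-\inf_{t\geqslant c}\overline{I}(t).$$ Moreover, $\underline{I}$ and $\overline{I}$ are nondecreasing functions.
   Context: Convention: $\log 0=-\infty$; the functions $\underline{I}_i,\overline{I}_i,\underline{I},\overline{I}$ take values in $[0,\infty]$. *)

theory Defs
  imports "HOL-Probability.Probability"
begin

(* The real logarithm has a junk value at 0, whereas the convention here is log 0 = -\<infinity>. *)
definition elog :: "real \<Rightarrow> ereal" where
  "elog x = (if x \<le> 0 then -\<infinity> else ereal (ln x))"

definition scaled_log :: "(nat \<Rightarrow> real) \<Rightarrow> (nat \<Rightarrow> real) \<Rightarrow> nat \<Rightarrow> ereal" where
  "scaled_log v p n = ereal (1 / v n) * elog (p n)"

definition lower_tail_rate ::
    "'a measure \<Rightarrow> (nat \<Rightarrow> real) \<Rightarrow> (nat \<Rightarrow> 'a \<Rightarrow> real) \<Rightarrow> real \<Rightarrow> ereal" where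
  "lower_tail_rate M v X a =
     - (INF u\<in>{..<a}. liminf (scaled_log v (\<lambda>n. \<P>(\<omega> in M. X n \<omega> > u))))"

definition upper_tail_rate ::
    "'a measure \<Rightarrow> (nat \<Rightarrow> real) \<Rightarrow> (nat \<Rightarrow> 'a \<Rightarrow> real) \<Rightarrow> real \<Rightarrow> ereal" where
  "upper_tail_rate M v X a =
     - (INF u\<in>{..<a}. limsup (scaled_log v (\<lambda>n. \<P>(\<omega> in M. X n \<omega> > u))))"

(* Used only for functions with values in [0, \<infinity>]: the tail rates above are nonnegative
   when v is positive and M is a probability space, so the form \<infinity> + (-\<infinity>) does not occur. *)
definition inf_convolution :: "(real \<Rightarrow> ereal) \<Rightarrow> (real \<Rightarrow> ereal) \<Rightarrow> real \<Rightarrow> ereal" where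
  "inf_convolution f g t = (INF (a, b)\<in>{(a, b). a + b = t}. f a + g b)"

end

theory Submission
  imports Defs
begin

text \<open>
  For the lower bound, a point \<open>(a, b)\<close> with \<open>a + b > c\<close> lies in an open quadrant
  \<open>{x > u, y > w}\<close> with \<open>u + w = c\<close>, contained in the half-plane \<open>{x + y > c}\<close>, and independence
  factorises the probability of the quadrant. For the upper bound, let \<open>K\<close> be less than the infimum
  of the rate on the line \<open>{x + y = c}\<close>. Every point of the line lies in an open quadrant whose
  probability decays faster than \<open>exp (- K v\<^sub>n)\<close>. By compactness finitely many of these quadrants cover
  a segment of the line, hence all points that dominate a point of the segment. If the
  segment is long enough, the rest of the half-plane \<open>{x + y \<ge> c}\<close> lies in the two corners controlled by the
  hypothesis.
\<close>

section \<open>Logarithmic asymptotics of products and finite sums\<close>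

lemma elog_mono: "x \<le> y \<Longrightarrow> elog x \<le> elog y"
  by (auto simp: elog_def)

lemma elog_mult: "0 \<le> x \<Longrightarrow> 0 \<le> y \<Longrightarrow> elog (x * y) = elog x + elog y"
  by (auto simp: elog_def mult_le_0_iff ln_mult)

lemma scaled_log_mono: "0 < v n \<Longrightarrow> p n \<le> q n \<Longrightarrow> scaled_log v p n \<le> scaled_log v q n"
  unfolding scaled_log_def by (intro ereal_mult_left_mono elog_mono) auto

lemma scaled_log_mult:
  assumes "0 < v n" "0 \<le> p n" "0 \<le> q n"
  shows "scaled_log v (\<lambda>n. p n * q n) n = scaled_log v p n + scaled_log v q n"
  unfolding scaled_log_def elog_mult[OF assms(2,3)]
  using assms by (auto simp: elog_def add_divide_distrib)

text \<open>Trades extended-real bounds for exponential ones. It survives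
  \<open>p n \<le> 0\<close>: the left side is then \<open>-\<infinity>\<close> and the exponential
  is positive, so both inequalities hold.\<close>

lemma scaled_log_le_iff:
  assumes "0 < v n"
  shows "scaled_log v p n \<le> ereal L \<longleftrightarrow> p n \<le> exp (L * v n)"
proof (cases "p n \<le> 0")
  case True
  then show ?thesis
    using assms exp_ge_zero[of "L * v n"] by (auto simp: scaled_log_def elog_def simp del: exp_ge_zero)
next
  case False
  then have "ln (p n) \<le> L * v n \<longleftrightarrow> p n \<le> exp (L * v n)"
    by (metis exp_le_cancel_iff exp_ln not_le)
  with False assms show ?thesis
    by (simp add: scaled_log_def elog_def field_simps)
qed

lemma scaled_log_nonpos: "0 < v n \<Longrightarrow> p n \<le> 1 \<Longrightarrow> scaled_log v p n \<le> 0"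
  using scaled_log_le_iff[of v n p 0] by (simp add: zero_ereal_def)

lemma limsup_scaled_log_nonpos:
  assumes "\<And>n. 0 < v n" "\<And>n. p n \<le> 1"
  shows "limsup (scaled_log v p) \<le> 0"
  by (intro Limsup_bounded always_eventually allI scaled_log_nonpos assms)

lemma liminf_scaled_log_nonpos:
  assumes "\<And>n. 0 < v n" "\<And>n. p n \<le> 1"
  shows "liminf (scaled_log v p) \<le> 0"
  using Liminf_le_Limsup[of sequentially "scaled_log v p"] limsup_scaled_log_nonpos[of v p] assms
  by (auto intro: order_trans)

text \<open>Eventually all terms are at most \<open>exp (- K * v n)\<close> at once, as
  \<open>A\<close> is finite. Summing costs a constant factor, whose logarithm is negligible against
  \<open>v n\<close>.\<close>

lemma limsup_scaled_log_sum_le: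
  assumes v: "\<And>n. 0 < v n" "filterlim v at_top sequentially"
    and A: "finite A"
    and p: "\<And>n. p n \<le> (\<Sum>i\<in>A. q i n)"
    and q: "\<And>i. i \<in> A \<Longrightarrow> limsup (scaled_log v (q i)) < ereal (- K)"
  shows "limsup (scaled_log v p) \<le> ereal (- K)"
proof -
  \<comment> \<open>The added 1 keeps \<open>ln N\<close> meaningful when \<open>A\<close> is
    empty.\<close>
  define N :: real where "N = real (card A) + 1"
  have N: "N > 0"
    by (simp add: N_def add_nonneg_pos)
  have "\<forall>\<^sub>F n in sequentially. \<forall>i\<in>A. scaled_log v (q i) n < ereal (- K)"
    using A q by (auto intro!: eventually_ball_finite Limsup_lessD)
  then have "\<forall>\<^sub>F n in sequentially. scaled_log v p n \<le> ereal (ln N / v n - K)"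
  proof eventually_elim
    case (elim n)
    have "p n \<le> (\<Sum>i\<in>A. q i n)"
      by (rule p)
    also have "\<dots> \<le> of_nat (card A) * exp (- K * v n)"
      using elim scaled_log_le_iff[of v n, OF v(1)] by (intro sum_bounded_above) (metis less_imp_le)
    also have "\<dots> \<le> N * exp (- K * v n)"
      by (simp add: N_def)
    also have "\<dots> = exp ((ln N / v n - K) * v n)"
    proof -
      have "(ln N / v n - K) * v n = ln N + - K * v n"
        using v(1)[of n] by (simp add: left_diff_distrib)
      with N show ?thesis
        by (simp only: exp_add exp_ln)
    qed
    finally show ?case
      using scaled_log_le_iff[of v n, OF v(1)] by blast
  qed
  then have "limsup (scaled_log v p) \<le> limsup (\<lambda>n. ereal (ln N / v n - K))"
    by (rule Limsup_mono)
  also have "(\<lambda>n. ln N / v n - K) \<longlonglongrightarrow> 0 - K"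
    by (intro tendsto_intros real_tendsto_divide_at_top[OF tendsto_const v(2)])
  then have "limsup (\<lambda>n. ereal (ln N / v n - K)) = ereal (- K)"
    by (intro lim_imp_Limsup) auto
  finally show ?thesis .
qed

lemma limsup_scaled_log_mult_le:
  assumes "\<And>n. 0 < v n" "\<And>n. 0 \<le> p n" "\<And>n. 0 \<le> q n"
  shows "limsup (scaled_log v (\<lambda>n. p n * q n)) \<le> limsup (scaled_log v p) + limsup (scaled_log v q)"
proof -
  have "scaled_log v (\<lambda>n. p n * q n) = (\<lambda>n. scaled_log v p n + scaled_log v q n)"
    using assms by (intro ext scaled_log_mult) auto
  then show ?thesis
    by (simp add: ereal_limsup_add_mono)
qed

text \<open>The bounds by 1 make both lower limits nonpositive. This excludes \<infinity> +
  (-\<infinity>), where superadditivity of \<open>liminf\<close> can fail.\<close>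

lemma liminf_scaled_log_mult_ge:
  assumes "\<And>n. 0 < v n" "\<And>n. 0 \<le> p n" "\<And>n. 0 \<le> q n" "\<And>n. p n \<le> 1" "\<And>n. q n \<le> 1"
  shows "liminf (scaled_log v p) + liminf (scaled_log v q) \<le> liminf (scaled_log v (\<lambda>n. p n * q n))"
proof -
  have "scaled_log v (\<lambda>n. p n * q n) = (\<lambda>n. scaled_log v p n + scaled_log v q n)"
    using assms by (intro ext scaled_log_mult) auto
  moreover have "liminf (scaled_log v p) \<le> 0" "liminf (scaled_log v q) \<le> 0"
    using assms by (auto intro: liminf_scaled_log_nonpos)
  ultimately show ?thesis
    by (auto intro!: ereal_liminf_add_mono)
qed

text \<open>Serves to write a sum of two rates as a supremum over pairs of thresholds. Nonnegativity
  keeps out the summand \<open>-\<infinity>\<close>, whose addition need not commute with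
  suprema.\<close>

lemma SUP_ereal_add_product:
  fixes f :: "'b \<Rightarrow> ereal" and g :: "'c \<Rightarrow> ereal"
  assumes "A \<noteq> {}" "B \<noteq> {}" "\<And>x. x \<in> A \<Longrightarrow> 0 \<le> f x" "\<And>y. y \<in> B \<Longrightarrow> 0 \<le> g y"
  shows "(SUP x\<in>A. f x) + (SUP y\<in>B. g y) = (SUP x\<in>A. SUP y\<in>B. f x + g y)"
proof -
  have "0 \<le> (SUP y\<in>B. g y)"
    using assms by (metis SUP_upper2 ex_in_conv)
  then have "(SUP x\<in>A. f x) + (SUP y\<in>B. g y) = (SUP x\<in>A. f x + (SUP y\<in>B. g y))"
    using assms by (subst SUP_ereal_add_left) auto
  also have "\<dots> = (SUP x\<in>A. SUP y\<in>B. f x + g y)"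
    using assms by (intro SUP_cong refl SUP_ereal_add_right[symmetric]) force+
  finally show ?thesis .
qed

section \<open>Monotonicity of the rates\<close>

lemma mono_lower_tail_rate: "mono (lower_tail_rate M v X)"
  unfolding lower_tail_rate_def by (intro monoI) (auto intro!: INF_superset_mono)

lemma mono_upper_tail_rate: "mono (upper_tail_rate M v X)"
  unfolding upper_tail_rate_def by (intro monoI) (auto intro!: INF_superset_mono)

text \<open>A splitting of \<open>t\<close> becomes one of \<open>s\<close> when \<open>a\<close> is
  kept and the second coordinate absorbs the whole decrease.\<close>

lemma mono_inf_convolution:
  assumes "mono g"
  shows "mono (inf_convolution f g)"
proof (rule monoI)
  fix s t :: real
  assume "s \<le> t"
  show "inf_convolution f g s \<le> inf_convolution f g t"
    unfolding inf_convolution_def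
  proof (rule INF_mono, clarify)
    fix a b :: real
    assume "t = a + b"
    with \<open>s \<le> t\<close> have "f a + g (s - a) \<le> f a + g b"
      by (intro add_left_mono monoD[OF assms]) auto
    then show "\<exists>m\<in>{(a, b). a + b = s}. (case m of (a, b) \<Rightarrow> f a + g b) \<le> f a + g b"
      by (intro bexI[of _ "(a, s - a)"]) auto
  qed
qed

section \<open>Tail bounds for sums of independent variables\<close>

context prob_space
begin

lemma indep_var_prob_quadrant:
  assumes "indep_var borel X borel Y"
  shows "\<P>(\<omega> in M. X \<omega> > (u :: real) \<and> Y \<omega> > (w :: real)) =
    \<P>(\<omega> in M. X \<omega> > u) * \<P>(\<omega> in M. Y \<omega> > w)"
proof -
  have "prob ((\<lambda>\<omega>. (X \<omega>, Y \<omega>)) -` ({u<..} \<times> {w<..}) \<inter> space M) =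
      prob (X -` {u<..} \<inter> space M) * prob (Y -` {w<..} \<inter> space M)"
    by (rule indep_varD[OF assms]) auto
  then show ?thesis
    by (simp add: vimage_def Int_def conj_commute)
qed

lemma liminf_sum_tail_ge:
  assumes Y: "\<And>n. indep_var borel (Y1 n) borel (Y2 n)"
    and v: "\<And>n. 0 < v n" and "c < t"
  shows "- inf_convolution (lower_tail_rate M v Y1) (lower_tail_rate M v Y2) t \<le>
    liminf (scaled_log v (\<lambda>n. \<P>(\<omega> in M. Y1 n \<omega> + Y2 n \<omega> > c)))"
    (is "- ?I \<le> ?L")
proof -
  have [measurable]: "Y1 n \<in> borel_measurable M" "Y2 n \<in> borel_measurable M" for n
    using indep_var_rv1[OF Y] indep_var_rv2[OF Y] by auto
  have "- ?L \<le> ?I"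
    unfolding inf_convolution_def
  proof (rule INF_greatest, clarify)
    fix a b :: real
    assume t: "t = a + b"
    \<comment> \<open>The excess \<open>t - c\<close> is shared equally, which puts the corner
      \<open>(u, w)\<close> on the line of sum \<open>c\<close>.\<close>
    define u where "u = a - (t - c) / 2"
    define w where "w = b - (t - c) / 2"
    have uw: "u < a" "w < b" "u + w = c"
      using \<open>c < t\<close> t by (auto simp: u_def w_def field_simps)
    let ?p = "\<lambda>n. \<P>(\<omega> in M. Y1 n \<omega> > u)" and ?q = "\<lambda>n. \<P>(\<omega> in M. Y2 n \<omega> > w)"
    have le0: "liminf (scaled_log v ?p) \<le> 0" "liminf (scaled_log v ?q) \<le> 0"
      using v by (auto intro!: liminf_scaled_log_nonpos)
    have "liminf (scaled_log v ?p) + liminf (scaled_log v ?q) \<le>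
        liminf (scaled_log v (\<lambda>n. ?p n * ?q n))"
      using v by (intro liminf_scaled_log_mult_ge) auto
    also have "\<dots> \<le> ?L"
    proof (intro Liminf_mono always_eventually allI scaled_log_mono v)
      fix n
      have "?p n * ?q n = \<P>(\<omega> in M. Y1 n \<omega> > u \<and> Y2 n \<omega> > w)"
        using indep_var_prob_quadrant[OF Y] by simp
      also have "\<dots> \<le> \<P>(\<omega> in M. Y1 n \<omega> + Y2 n \<omega> > c)"
        using uw by (intro finite_measure_mono) auto
      finally show "?p n * ?q n \<le> \<P>(\<omega> in M. Y1 n \<omega> + Y2 n \<omega> > c)" .
    qed
    finally have "- ?L \<le> - (liminf (scaled_log v ?p) + liminf (scaled_log v ?q))"
      by simp
    \<comment> \<open>Negation distributes because both terms are nonpositive.\<close>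
    also have "\<dots> = - liminf (scaled_log v ?p) + - liminf (scaled_log v ?q)"
      using le0 by (cases "liminf (scaled_log v ?p)"; cases "liminf (scaled_log v ?q)") auto
    also have "\<dots> \<le> lower_tail_rate M v Y1 a + lower_tail_rate M v Y2 b"
      unfolding lower_tail_rate_def using uw by (intro add_mono) (auto intro!: INF_lower)
    finally show "- ?L \<le> lower_tail_rate M v Y1 a + lower_tail_rate M v Y2 b" .
  qed
  then show ?thesis
    by (subst ereal_uminus_le_reorder)
qed

text \<open>The sum of the rates is a supremum over pairs \<open>u < a\<close>,
  \<open>w < b\<close>, so a single pair already exceeds \<open>K\<close>. Independence passes this
  to the probability of the quadrant.\<close>

lemma upper_tail_rate_quadrant:
  assumes Y: "\<And>n. indep_var borel (Y1 n) borel (Y2 n)"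
    and v: "\<And>n. 0 < v n"
    and K: "ereal K < upper_tail_rate M v Y1 a + upper_tail_rate M v Y2 b"
  obtains u w where "u < a" "w < b"
    "limsup (scaled_log v (\<lambda>n. \<P>(\<omega> in M. Y1 n \<omega> > u \<and> Y2 n \<omega> > w))) < ereal (- K)"
proof -
  let ?L1 = "\<lambda>u. limsup (scaled_log v (\<lambda>n. \<P>(\<omega> in M. Y1 n \<omega> > u)))"
  let ?L2 = "\<lambda>w. limsup (scaled_log v (\<lambda>n. \<P>(\<omega> in M. Y2 n \<omega> > w)))"
  have le0: "?L1 u \<le> 0" "?L2 u \<le> 0" for u
    using v by (auto intro!: limsup_scaled_log_nonpos)
  have "upper_tail_rate M v Y1 a + upper_tail_rate M v Y2 b =
      (SUP u\<in>{..<a}. SUP w\<in>{..<b}. - ?L1 u + - ?L2 w)"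
    unfolding upper_tail_rate_def ereal_SUP_uminus_eq[symmetric]
    using le0 by (intro SUP_ereal_add_product) auto
  with K obtain u w where uw: "u < a" "w < b" and "ereal K < - ?L1 u + - ?L2 w"
    by (auto simp: less_SUP_iff)
  with le0[of u] le0[of w] have lt: "?L1 u + ?L2 w < ereal (- K)"
    by (cases "?L1 u"; cases "?L2 w") auto
  have "limsup (scaled_log v (\<lambda>n. \<P>(\<omega> in M. Y1 n \<omega> > u \<and> Y2 n \<omega> > w))) \<le> ?L1 u + ?L2 w"
    unfolding indep_var_prob_quadrant[OF Y] using v by (intro limsup_scaled_log_mult_le) auto
  with lt uw that show thesis
    by (meson le_less_trans)
qed

text \<open>The bound uses the rate at \<open>c\<close> alone; by monotonicity this is its infimum
  over \<open>t \<ge> c\<close>.\<close>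

lemma limsup_sum_tail_le:
  assumes Y: "\<And>n. indep_var borel (Y1 n) borel (Y2 n)"
    and v: "\<And>n. 0 < v n" "filterlim v at_top sequentially"
    and corner: "\<And>K :: real. K > 0 \<Longrightarrow> \<exists>d>0.
           limsup (scaled_log v (\<lambda>n. \<P>(\<omega> in M. Y1 n \<omega> > d \<and> Y2 n \<omega> < - d))) < ereal (- K) \<and>
           limsup (scaled_log v (\<lambda>n. \<P>(\<omega> in M. Y1 n \<omega> < - d \<and> Y2 n \<omega> > d))) < ereal (- K)"
  shows "limsup (scaled_log v (\<lambda>n. \<P>(\<omega> in M. Y1 n \<omega> + Y2 n \<omega> \<ge> c))) \<le>
    - inf_convolution (upper_tail_rate M v Y1) (upper_tail_rate M v Y2) c"
    (is "?L \<le> - ?I")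
proof -
  have [measurable]: "Y1 n \<in> borel_measurable M" "Y2 n \<in> borel_measurable M" for n
    using indep_var_rv1[OF Y] indep_var_rv2[OF Y] by auto
  \<comment> \<open>Testing against every real \<open>K\<close> below \<open>?I\<close> also covers
    \<open>?I = \<infinity>\<close>.\<close>
  have "ereal K \<le> - ?L" if K: "ereal K < ?I" for K
  proof (cases "K > 0")
    case False
    have "?L \<le> 0"
      using v by (intro limsup_scaled_log_nonpos) auto
    with False show ?thesis
      by (cases ?L) auto
  next
    case True
    then obtain d where "d > 0"
      and d1: "limsup (scaled_log v (\<lambda>n. \<P>(\<omega> in M. Y1 n \<omega> > d \<and> Y2 n \<omega> < - d))) < ereal (- K)"
      and d2: "limsup (scaled_log v (\<lambda>n. \<P>(\<omega> in M. Y1 n \<omega> < - d \<and> Y2 n \<omega> > d))) < ereal (- K)"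
      using corner by blast
    define Q where "Q u w \<longleftrightarrow>
      limsup (scaled_log v (\<lambda>n. \<P>(\<omega> in M. Y1 n \<omega> > u \<and> Y2 n \<omega> > w))) < ereal (- K)" for u w
    have "\<exists>u w. u < a \<and> w < c - a \<and> Q u w" for a
    proof -
      have "?I \<le> (case (a, c - a) of (a, b) \<Rightarrow> upper_tail_rate M v Y1 a + upper_tail_rate M v Y2 b)"
        unfolding inf_convolution_def by (rule INF_lower) simp
      with K have "ereal K < upper_tail_rate M v Y1 a + upper_tail_rate M v Y2 (c - a)"
        by simp
      then show ?thesis
        unfolding Q_def by (rule upper_tail_rate_quadrant[OF Y v(1)]) blast
    qed
    then obtain u w where uw: "\<And>a. u a < a" "\<And>a. w a < c - a"
      and Q: "\<And>a. Q (u a) (w a)"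
      by metis
    \<comment> \<open>Since \<open>c - D \<le> - d\<close> and \<open>c + D \<ge> d\<close>, the
      half-plane points left uncovered beyond the segment fall into the corners given by
      \<open>d\<close>.\<close>
    define D where "D = d + \<bar>c\<bar>"
    \<comment> \<open>The line is parametrised by its first coordinate; the interval is the trace on
      it of the quadrant with corner \<open>(u a, w a)\<close>, and it contains
      \<open>a\<close>.\<close>
    obtain A where A: "finite A" and cover: "{-D..D} \<subseteq> (\<Union>a\<in>A. {u a<..<c - w a})"
    proof (rule compactE_image[of "{-D..D}" UNIV "\<lambda>a. {u a<..<c - w a}"])
      show "{-D..D} \<subseteq> (\<Union>a. {u a<..<c - w a})"
      proof
        fix x
        show "x \<in> (\<Union>a. {u a<..<c - w a})"
          using uw[of x] by (auto intro!: exI[of _ x])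
      qed
    qed auto
    \<comment> \<open>The nested options index the two corners and the quadrants by one type, so
      that a single finite sum bounds the probability.\<close>
    define E where "E i = (case i of
        None \<Rightarrow> {x. fst x > d \<and> snd x < - d}
      | Some None \<Rightarrow> {x. fst x < - d \<and> snd x > d}
      | Some (Some a) \<Rightarrow> {x. fst x > u a \<and> snd x > w a})" for i :: "real option option"
    define J where "J = {None, Some None} \<union> (\<lambda>a. Some (Some a)) ` A"
    have half_plane: "\<exists>i\<in>J. (x, y) \<in> E i" if "c \<le> x + y" for x y
    proof -
      \<comment> \<open>The cases are asymmetric: \<open>x < - D\<close> forces
        \<open>y > c + D\<close>, whereas \<open>x > D\<close> leaves \<open>y\<close> on either
        side of \<open>c - D\<close>.\<close>
      consider "x \<in> {-D..D}" | "x > D" "y \<ge> c - D" | "x > D" "y < c - D" | "x < - D"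
        by force
      then show ?thesis
      proof cases
        case 1
        then obtain a where "a \<in> A" "u a < x" "x < c - w a"
          using cover by auto
        with that show ?thesis
          by (intro bexI[of _ "Some (Some a)"]) (auto simp: E_def J_def)
      next
        case 2
        \<comment> \<open>Here \<open>(x, y)\<close> dominates the endpoint
          \<open>(D, c - D)\<close>, so a quadrant covering the endpoint contains it.\<close>
        have "D \<in> {-D..D}"
          using \<open>d > 0\<close> by (simp add: D_def)
        from subsetD[OF cover this] obtain a where "a \<in> A" "u a < D" "D < c - w a"
          by auto
        with 2 show ?thesis
          by (intro bexI[of _ "Some (Some a)"]) (auto simp: E_def J_def)
      next
        case 3
        then show ?thesis
          by (intro bexI[of _ None]) (auto simp: E_def J_def D_def)
      next
        case 4
        with that show ?thesis
          by (intro bexI[of _ "Some None"]) (auto simp: E_def J_def D_def)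
      qed
    qed
    have E_sets: "{\<omega> \<in> space M. (Y1 n \<omega>, Y2 n \<omega>) \<in> E i} \<in> sets M" for n i
      by (auto simp: E_def split: option.split)
    have "?L \<le> ereal (- K)"
    proof (rule limsup_scaled_log_sum_le[OF v, where A = J and q = "\<lambda>i n. \<P>(\<omega> in M. (Y1 n \<omega>, Y2 n \<omega>) \<in> E i)"])
      show "finite J"
        using A by (simp add: J_def)
      show "limsup (scaled_log v (\<lambda>n. \<P>(\<omega> in M. (Y1 n \<omega>, Y2 n \<omega>) \<in> E i))) < ereal (- K)" for i
        using d1 d2 Q by (auto simp: E_def Q_def split: option.split)
      fix n
      have "\<P>(\<omega> in M. Y1 n \<omega> + Y2 n \<omega> \<ge> c) \<le> prob (\<Union>i\<in>J. {\<omega> \<in> space M. (Y1 n \<omega>, Y2 n \<omega>) \<in> E i})"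
        using half_plane E_sets \<open>finite J\<close> by (intro finite_measure_mono) auto
      also have "\<dots> \<le> (\<Sum>i\<in>J. \<P>(\<omega> in M. (Y1 n \<omega>, Y2 n \<omega>) \<in> E i))"
        using E_sets \<open>finite J\<close> by (intro finite_measure_subadditive_finite) auto
      finally show "\<P>(\<omega> in M. Y1 n \<omega> + Y2 n \<omega> \<ge> c) \<le> (\<Sum>i\<in>J. \<P>(\<omega> in M. (Y1 n \<omega>, Y2 n \<omega>) \<in> E i))" .
    qed
    then show ?thesis
      by (cases ?L) auto
  qed
  \<comment> \<open>If \<open>- ?L < ?I\<close>, a real number strictly between them would
    contradict the bound.\<close>
  then have "?I \<le> - ?L"
    by (meson ereal_dense2 leD leI)
  then show ?thesis
    using ereal_minus_le_minus[of "- ?L" ?I] by (simp only: ereal_uminus_uminus)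
qed

end

theorem proposition6:
  fixes M :: "'a measure"
    and Y :: "nat \<Rightarrow> 'a \<Rightarrow> real \<times> real"
    and Y1 Y2 :: "nat \<Rightarrow> 'a \<Rightarrow> real"
    and v :: "nat \<Rightarrow> real"
    and I_low I_up :: "real \<Rightarrow> ereal"
  assumes "prob_space M"
    and "\<And>n. Y n \<in> borel_measurable M"
    and "Y1 = (\<lambda>n \<omega>. fst (Y n \<omega>))" and "Y2 = (\<lambda>n \<omega>. snd (Y n \<omega>))"
    and "\<And>n. prob_space.indep_var M borel (Y1 n) borel (Y2 n)"
    and "\<And>n. v n > 0" and "filterlim v at_top sequentially"
    and "\<And>K :: real. K > 0 \<Longrightarrow> \<exists>d>0.
           limsup (scaled_log v (\<lambda>n. \<P>(\<omega> in M. Y1 n \<omega> > d \<and> Y2 n \<omega> < - d))) < ereal (- K) \<and>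
           limsup (scaled_log v (\<lambda>n. \<P>(\<omega> in M. Y1 n \<omega> < - d \<and> Y2 n \<omega> > d))) < ereal (- K)"
    and "I_low = inf_convolution (lower_tail_rate M v Y1) (lower_tail_rate M v Y2)"
    and "I_up = inf_convolution (upper_tail_rate M v Y1) (upper_tail_rate M v Y2)"
  shows "(\<forall>c :: real.
            - (INF t\<in>{c<..}. I_low t)
              \<le> liminf (scaled_log v (\<lambda>n. \<P>(\<omega> in M. Y1 n \<omega> + Y2 n \<omega> > c))) \<and>
            liminf (scaled_log v (\<lambda>n. \<P>(\<omega> in M. Y1 n \<omega> + Y2 n \<omega> > c)))
              \<le> limsup (scaled_log v (\<lambda>n. \<P>(\<omega> in M. Y1 n \<omega> + Y2 n \<omega> \<ge> c))) \<and>
            limsup (scaled_log v (\<lambda>n. \<P>(\<omega> in M. Y1 n \<omega> + Y2 n \<omega> \<ge> c)))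
              \<le> - (INF t\<in>{c..}. I_up t)) \<and>
         mono I_low \<and> mono I_up"
proof -
  interpret prob_space M by fact
  note Y = assms(5) and v = assms(6,7) and I = assms(9,10)
  have [measurable]: "Y1 n \<in> borel_measurable M" "Y2 n \<in> borel_measurable M" for n
    using indep_var_rv1[OF Y] indep_var_rv2[OF Y] by auto
  have mono: "mono I_low" "mono I_up"
    unfolding I by (auto intro: mono_inf_convolution mono_lower_tail_rate mono_upper_tail_rate)
  have "- (INF t\<in>{c<..}. I_low t) \<le> liminf (scaled_log v (\<lambda>n. \<P>(\<omega> in M. Y1 n \<omega> + Y2 n \<omega> > c)))" for c
    unfolding I ereal_SUP_uminus_eq[symmetric]
    by (intro SUP_least liminf_sum_tail_ge Y v) auto
  moreover have "liminf (scaled_log v (\<lambda>n. \<P>(\<omega> in M. Y1 n \<omega> + Y2 n \<omega> > c))) \<le>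
      limsup (scaled_log v (\<lambda>n. \<P>(\<omega> in M. Y1 n \<omega> + Y2 n \<omega> \<ge> c)))" for c
  proof -
    have "liminf (scaled_log v (\<lambda>n. \<P>(\<omega> in M. Y1 n \<omega> + Y2 n \<omega> > c))) \<le>
        liminf (scaled_log v (\<lambda>n. \<P>(\<omega> in M. Y1 n \<omega> + Y2 n \<omega> \<ge> c)))"
      by (intro Liminf_mono always_eventually allI scaled_log_mono v finite_measure_mono) auto
    also have "\<dots> \<le> limsup (scaled_log v (\<lambda>n. \<P>(\<omega> in M. Y1 n \<omega> + Y2 n \<omega> \<ge> c)))"
      by (rule Liminf_le_Limsup) simp
    finally show ?thesis .
  qed
  moreover have "limsup (scaled_log v (\<lambda>n. \<P>(\<omega> in M. Y1 n \<omega> + Y2 n \<omega> \<ge> c))) \<le>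
      - (INF t\<in>{c..}. I_up t)" for c
  proof -
    have "limsup (scaled_log v (\<lambda>n. \<P>(\<omega> in M. Y1 n \<omega> + Y2 n \<omega> \<ge> c))) \<le> - I_up c"
      unfolding I by (rule limsup_sum_tail_le[OF Y v assms(8)])
    \<comment> \<open>Monotonicity places the infimum at the left endpoint.\<close>
    also have "I_up c = (INF t\<in>{c..}. I_up t)"
      by (intro antisym INF_greatest INF_lower monoD[OF mono(2)]) auto
    finally show ?thesis .
  qed
  ultimately show ?thesis
    using mono by blast
qed

end
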